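(* Let $H$ be an arbitrary graph on $n$ vertices, and let $k$ be a positive integer. Then: (i) $\mathfrak{C}(H,k) = \mathfrak{C}^\uparrow(H,k) \cap \mathfrak{C}^\downarrow(H,k)$; (ii) $\mathfrak{C}(H,k) = \mathfrak{C}^\uparrow(H,k) \cap F = \mathfrak{C}^\downarrow(H,k) \cap F$, where $F = \{x \in \mathbb{Q}^n : \sum_{u=1}^n x_u = k\}$.
   Context: Identify the vertex set of $H$ with $[n]=\{1,\dots,n\}$. A stable set in $H$ is a set of pairwise non-adjacent vertices; its incidence vector $\chi^S\in\{0,1\}^n$ has $\chi^S_i=1$ iff $i\in S$. Define $\mathfrak{C}(H,k)$ as the convex hull of the incidence vectors of stable sets of cardinality exactly $k$ in $H$; $\mathfrak{C}^\uparrow(H,k)$ as the convex hull of the incidence vectors of stable sets of cardinality at least $k$; and $\mathfrak{C}^\downarrow(H,k)$ as the convex hull of the incidence vectors of stable sets of cardinality at most $k$. *)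

theory Defs
  imports "HOL-Analysis.Finite_Cartesian_Product" "Graph_Theory.Pair_Digraph"
begin

text \<open>
  A graph on \<open>n\<close> vertices is a \<open>pair_graph\<close> (finite, loopless, symmetric arc relation) whose vertex
  set is the whole finite type \<open>'n\<close>, with \<open>n = CARD('n)\<close>; thus \<open>\<rat>\<^sup>n\<close> is \<open>rat ^ 'n\<close>.
\<close>

definition stable_set :: "'n pair_pre_digraph \<Rightarrow> 'n set \<Rightarrow> bool" where
  "stable_set H S \<longleftrightarrow> S \<subseteq> pverts H \<and> pairwise (\<lambda>u v. (u, v) \<notin> parcs H) S"

definition incidence_vector :: "'n set \<Rightarrow> rat ^ 'n" where
  "incidence_vector S = (\<chi> i. if i \<in> S then 1 else 0)"

text \<open>
  The library's \<open>convex\<close> is restricted to real vector spaces; this is the same definition over the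
  rationals. The convex hull of \<open>A\<close> in \<open>\<rat>\<^sup>n\<close> is then \<open>rat_convex hull A\<close>.
\<close>

definition rat_convex :: "(rat ^ 'n) set \<Rightarrow> bool" where
  "rat_convex A \<longleftrightarrow>
    (\<forall>x\<in>A. \<forall>y\<in>A. \<forall>u\<ge>0. \<forall>v\<ge>0. u + v = 1 \<longrightarrow> u *s x + v *s y \<in> A)"

lemma rat_convex_convex_hull: "rat_convex (rat_convex hull A)"
  by (rule hull_in) (auto simp: rat_convex_def)

definition stable_polytope :: "('n::finite) pair_pre_digraph \<Rightarrow> nat \<Rightarrow> (rat ^ 'n) set"
  ("\<CC>") where
  "\<CC> H k = rat_convex hull {incidence_vector S | S. stable_set H S \<and> card S = k}"

definition stable_polytope_up :: "('n::finite) pair_pre_digraph \<Rightarrow> nat \<Rightarrow> (rat ^ 'n) set"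
  ("\<CC>\<^sup>\<up>") where
  "\<CC>\<^sup>\<up> H k = rat_convex hull {incidence_vector S | S. stable_set H S \<and> card S \<ge> k}"

definition stable_polytope_down :: "('n::finite) pair_pre_digraph \<Rightarrow> nat \<Rightarrow> (rat ^ 'n) set"
  ("\<CC>\<^sup>\<down>") where
  "\<CC>\<^sup>\<down> H k = rat_convex hull {incidence_vector S | S. stable_set H S \<and> card S \<le> k}"

definition card_hyperplane :: "nat \<Rightarrow> (rat ^ 'n::finite) set" where
  "card_hyperplane k = {x. (\<Sum>u\<in>UNIV. x $ u) = of_nat k}"

end

theory Submission
  imports Defs
begin

text \<open>
  All generators of \<open>\<CC>\<^sup>\<up> H k\<close> have coordinate sum at least \<open>k\<close>, and all generators of
  \<open>\<CC>\<^sup>\<down> H k\<close> have coordinate sum at most \<open>k\<close>. So \<open>card_hyperplane k\<close> supports both polytopes and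
  cuts out the face spanned by the generators lying on it, which is \<open>\<CC> H k\<close> in both cases.
  A common point of the two polytopes has coordinate sum exactly \<open>k\<close>.
\<close>

text \<open>Linearity is assumed only as an identity on two-term combinations, so a coordinate sum
  and its negation are both instances, and upper bounds need no lemma of their own.\<close>

lemma rat_convex_halfspace:
  fixes f :: "rat ^ 'n \<Rightarrow> rat"
  assumes lin: "\<And>u v x y. f (u *s x + v *s y) = u * f x + v * f y"
  shows "rat_convex {x. c \<le> f x}"
  unfolding rat_convex_def
proof (intro ballI allI impI)
  fix x y and u v :: rat
  assume *: "x \<in> {x. c \<le> f x}" "y \<in> {x. c \<le> f x}" "0 \<le> u" "0 \<le> v" "u + v = 1"
  have "c = u * c + v * c"
    using *(5) by (metis distrib_right mult_1)
  also have "\<dots> \<le> u * f x + v * f y"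
    using * by (intro add_mono mult_left_mono) auto
  finally show "u *s x + v *s y \<in> {x. c \<le> f x}"
    by (simp add: lin)
qed

lemma rat_convex_hull_ge:
  fixes f :: "rat ^ 'n \<Rightarrow> rat"
  assumes "\<And>u v x y. f (u *s x + v *s y) = u * f x + v * f y"
    and "\<And>a. a \<in> A \<Longrightarrow> c \<le> f a"
    and "x \<in> rat_convex hull A"
  shows "c \<le> f x"
proof -
  have "rat_convex hull A \<subseteq> {x. c \<le> f x}"
    using assms(2) by (intro hull_minimal rat_convex_halfspace assms(1)) auto
  with assms(3) show ?thesis by auto
qed

text \<open>The hull is handled through minimality alone, without explicit finite convex
  combinations: it suffices to find a convex superset of \<open>A\<close> whose part on the
  hyperplane is already the hull of the generators lying there.\<close>

lemma rat_convex_hull_supporting_hyperplane: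
  fixes f :: "rat ^ 'n \<Rightarrow> rat"
  assumes lin: "\<And>u v x y. f (u *s x + v *s y) = u * f x + v * f y"
    and ge: "\<And>a. a \<in> A \<Longrightarrow> c \<le> f a"
  shows "rat_convex hull A \<inter> {x. f x = c} = rat_convex hull {a \<in> A. f a = c}"
    (is "_ = rat_convex hull ?B")
proof
  \<comment> \<open>A proper convex combination leaves the hyperplane as soon as one of its points does.\<close>
  let ?T = "{x. f x > c \<or> f x = c \<and> x \<in> rat_convex hull ?B}"
  have "rat_convex ?T"
  proof (intro rat_convex_def[THEN iffD2] ballI allI impI)
    fix x y and u v :: rat
    assume x: "x \<in> ?T" and y: "y \<in> ?T" and uv: "0 \<le> u" "0 \<le> v" "u + v = 1"
    have c: "c = u * c + v * c"
      using uv(3) by (metis distrib_right mult_1)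
    \<comment> \<open>Zero weights are split off because a point strictly above the hyperplane
      pushes the combination above it only if its weight is positive.\<close>
    consider "u = 0" | "v = 0" | "f x = c" "f y = c" | "u > 0" "v > 0" "f x > c \<or> f y > c"
      using x y uv by fastforce
    then show "u *s x + v *s y \<in> ?T"
    proof cases
      case 1
      then show ?thesis using y uv by simp
    next
      case 2
      then show ?thesis using x uv by simp
    next
      case 3
      then have "u *s x + v *s y \<in> rat_convex hull ?B"
        using x y uv rat_convex_convex_hull[of ?B] by (auto simp: rat_convex_def)
      with 3 c show ?thesis by (simp add: lin)
    next
      case 4
      have "c \<le> f x" "c \<le> f y" using x y by auto
      with 4 have "u * c + v * c < u * f x + v * f y"
        by (auto intro: add_less_le_mono add_le_less_mono)
      with c show ?thesis by (simp add: lin)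
    qed
  qed
  moreover have "A \<subseteq> ?T"
    using ge by (force intro: hull_inc)
  ultimately have "rat_convex hull A \<subseteq> ?T"
    by (intro hull_minimal)
  then show "rat_convex hull A \<inter> {x. f x = c} \<subseteq> rat_convex hull ?B"
    by auto
next
  \<comment> \<open>On \<open>?B\<close> both \<open>f\<close> and its negation attain their bounds,
    so the two inequalities force \<open>f x = c\<close> on the hull.\<close>
  have "c \<le> f x \<and> - c \<le> - f x" if "x \<in> rat_convex hull ?B" for x
    using rat_convex_hull_ge[of f ?B c x] rat_convex_hull_ge[of "\<lambda>x. - f x" ?B "- c" x] that
    by (auto simp: lin)
  moreover have "rat_convex hull ?B \<subseteq> rat_convex hull A"
    by (intro hull_mono) auto
  ultimately show "rat_convex hull ?B \<subseteq> rat_convex hull A \<inter> {x. f x = c}"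
    by force
qed

lemma sum_coordinates_linear:
  fixes x y :: "rat ^ 'n::finite"
  shows "(\<Sum>i\<in>UNIV. (u *s x + v *s y) $ i) = u * (\<Sum>i\<in>UNIV. x $ i) + v * (\<Sum>i\<in>UNIV. y $ i)"
  by (simp add: sum.distrib sum_distrib_left)

lemma sum_incidence_vector:
  "(\<Sum>i\<in>UNIV. incidence_vector S $ i) = of_nat (card (S :: 'n::finite set))"
  by (simp add: incidence_vector_def sum.If_cases)

lemma stable_polytope_up_Int_card_hyperplane: "\<CC>\<^sup>\<up> H k \<inter> card_hyperplane k = \<CC> H k"
proof -
  let ?A = "{incidence_vector S | S. stable_set H S \<and> card S \<ge> k}"
  have "\<CC>\<^sup>\<up> H k \<inter> card_hyperplane k
      = rat_convex hull {a \<in> ?A. (\<Sum>i\<in>UNIV. a $ i) = of_nat k}"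
    unfolding stable_polytope_up_def card_hyperplane_def
    by (rule rat_convex_hull_supporting_hyperplane)
      (auto simp only: sum_coordinates_linear sum_incidence_vector of_nat_le_iff)
  also have "{a \<in> ?A. (\<Sum>i\<in>UNIV. a $ i) = of_nat k}
      = {incidence_vector S | S. stable_set H S \<and> card S = k}"
    by (auto simp: sum_incidence_vector)
  finally show ?thesis
    by (simp add: stable_polytope_def)
qed

lemma stable_polytope_down_Int_card_hyperplane: "\<CC>\<^sup>\<down> H k \<inter> card_hyperplane k = \<CC> H k"
proof -
  let ?A = "{incidence_vector S | S. stable_set H S \<and> card S \<le> k}"
  \<comment> \<open>Negating the coordinate sum turns the upper bound \<open>k\<close> on the
    generators into the lower bound \<open>- of_nat k\<close> that the face lemma expects.\<close>
  have "card_hyperplane k = {x :: rat ^ 'a. - (\<Sum>i\<in>UNIV. x $ i) = - of_nat k}"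
    by (simp add: card_hyperplane_def)
  then have "\<CC>\<^sup>\<down> H k \<inter> card_hyperplane k
      = rat_convex hull ?A \<inter> {x. - (\<Sum>i\<in>UNIV. x $ i) = - of_nat k}"
    by (simp add: stable_polytope_down_def)
  also have "\<dots> = rat_convex hull {a \<in> ?A. - (\<Sum>i\<in>UNIV. a $ i) = - of_nat k}"
    by (rule rat_convex_hull_supporting_hyperplane)
      (auto simp only: sum_coordinates_linear sum_incidence_vector of_nat_le_iff neg_le_iff_le
        minus_add_distrib mult_minus_right)
  also have "{a \<in> ?A. - (\<Sum>i\<in>UNIV. a $ i) = - of_nat k}
      = {incidence_vector S | S. stable_set H S \<and> card S = k}"
    by (auto simp: sum_incidence_vector)
  finally show ?thesis
    by (simp add: stable_polytope_def)
qed

lemma stable_polytope_up_Int_down_subset: "\<CC>\<^sup>\<up> H k \<inter> \<CC>\<^sup>\<down> H k \<subseteq> card_hyperplane k"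
proof
  fix x assume x: "x \<in> \<CC>\<^sup>\<up> H k \<inter> \<CC>\<^sup>\<down> H k"
  have "of_nat k \<le> (\<Sum>i\<in>UNIV. x $ i)"
    by (rule rat_convex_hull_ge[where A = "{incidence_vector S | S. stable_set H S \<and> card S \<ge> k}"])
      (use x in \<open>auto simp only: sum_coordinates_linear sum_incidence_vector of_nat_le_iff
        stable_polytope_up_def\<close>)
  moreover have "- of_nat k \<le> - (\<Sum>i\<in>UNIV. x $ i)"
    by (rule rat_convex_hull_ge[where A = "{incidence_vector S | S. stable_set H S \<and> card S \<le> k}"])
      (use x in \<open>auto simp only: sum_coordinates_linear sum_incidence_vector of_nat_le_iff
        stable_polytope_down_def neg_le_iff_le minus_add_distrib mult_minus_right\<close>)
  ultimately show "x \<in> card_hyperplane k"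
    by (simp add: card_hyperplane_def)
qed

theorem theorem2p1:
  fixes H :: "('n::finite) pair_pre_digraph" and k :: nat
  assumes "pair_graph H" and "pverts H = UNIV" and "k > 0"
  shows "\<CC> H k = \<CC>\<^sup>\<up> H k \<inter> \<CC>\<^sup>\<down> H k \<and>
    (\<CC> H k = \<CC>\<^sup>\<up> H k \<inter> card_hyperplane k \<and>
      \<CC>\<^sup>\<up> H k \<inter> card_hyperplane k = \<CC>\<^sup>\<down> H k \<inter> card_hyperplane k)"
  \<comment> \<open>For the first equation, the intersection of the two polytopes lies in the
    hyperplane, so it equals the intersection of their two faces there, and both faces are
    \<open>\<CC> H k\<close>.\<close>
  using stable_polytope_up_Int_card_hyperplane[of H k]
    stable_polytope_down_Int_card_hyperplane[of H k]
    stable_polytope_up_Int_down_subset[of H k]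
  by blast

end
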